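(* Let $r,r'\in\mathbb{Z}_2$. Then $P(r')\otimes P(r)\cong 2P(0)\oplus 2P(1)$ as $D_4$-modules.
   Context: Let $k$ be an algebraically closed field with $\mathrm{char}(k)\neq 2$. All modules are finite-dimensional left modules; $\otimes=\otimes_k$; $\mathbb{Z}_2=\mathbb{Z}/2\mathbb{Z}$; $nM$ denotes the direct sum of $n$ copies of $M$. $D_4$ is the $k$-algebra generated by $a,b,c,d$ subject to $ba=-ab$, $db=-bd$, $ca=-ac$, $dc=-cd$, $bc=cb$, $a^2=0$, $b^2=1$, $c^2=1$, $d^2=0$, $da+ad=1-bc$. It is a $16$-dimensional Hopf algebra (isomorphic to the Drinfeld double of Sweedler's 4-dimensional Hopf algebra) with comultiplication $\Delta(a)=a\otimes b+1\otimes a$, $\Delta(b)=b\otimes b$, $\Delta(c)=c\otimes c$, $\Delta(d)=d\otimes c+1\otimes d$, counit $\varepsilon(a)=\varepsilon(d)=0$, $\varepsilon(b)=\varepsilon(c)=1$, antipode $S(a)=-ab$, $S(b)=b$, $S(c)=c$, $S(d)=-dc$. Tensor products of $D_4$-modules are $D_4$-modules via $\Delta$. For $r\in\mathbb{Z}_2$, $P(r)$ is the projective cover of the one-dimensional simple module $V(r)$ on which $a,d$ act as $0$ and $b,c$ act as $(-1)^r$; explicitly, $P(r)$ has a basis $v_1,v_2,v_3,v_4$ with $av_1=v_2$, $dv_1=v_3$, $av_2=0$, $dv_2=-v_4$, $av_3=v_4$, $dv_3=0$, $av_4=dv_4=0$, where $b$ and $c$ both act as $(-1)^r$ on $v_1,v_4$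 and as $(-1)^{r+1}$ on $v_2,v_3$. *)

theory Defs
  imports "HOL-Analysis.Cartesian_Space" "HOL-Library.Poly_Mapping" "HOL-Library.Z2"
    "HOL-Computational_Algebra.Polynomial"
begin

section \<open>Two-sided ideals and linear extension\<close>

inductive_set ideal_gen :: "'a::ring_1 set \<Rightarrow> 'a set" for R where
  zero: "0 \<in> ideal_gen R"
| gen: "r \<in> R \<Longrightarrow> x * r * y \<in> ideal_gen R"
| add: "u \<in> ideal_gen R \<Longrightarrow> v \<in> ideal_gen R \<Longrightarrow> u + v \<in> ideal_gen R"

lemma ideal_gen_mult: "u \<in> ideal_gen R \<Longrightarrow> p * u * q \<in> ideal_gen R"
proof (induction rule: ideal_gen.induct)
  case zero
  then show ?case by (simp add: ideal_gen.zero)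
next
  case (gen r x y)
  then show ?case using ideal_gen.gen[of r R "p * x" "y * q"] by (simp add: mult.assoc)
next
  case (add u v)
  then show ?case by (simp add: distrib_left distrib_right ideal_gen.add)
qed

lemma ideal_gen_uminus: "u \<in> ideal_gen R \<Longrightarrow> - u \<in> ideal_gen R"
  using ideal_gen_mult[of u R "- 1" 1] by simp

lemma ideal_gen_base: "r \<in> R \<Longrightarrow> r \<in> ideal_gen R"
  using ideal_gen.gen[of r R 1 1] by simp

lemma ideal_gen_equivp: "equivp (\<lambda>x y. x - y \<in> ideal_gen R)"
proof (rule equivpI)
  show "reflp (\<lambda>x y. x - y \<in> ideal_gen R)"
    by (simp add: reflp_def ideal_gen.zero)
  show "symp (\<lambda>x y. x - y \<in> ideal_gen R)"
    unfolding symp_def using ideal_gen_uminus by fastforce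
  show "transp (\<lambda>x y. x - y \<in> ideal_gen R)"
    unfolding transp_def using ideal_gen.add by fastforce
qed

lemma ideal_gen_cong_add:
  "x - x' \<in> ideal_gen R \<Longrightarrow> y - y' \<in> ideal_gen R \<Longrightarrow> (x + y) - (x' + y') \<in> ideal_gen R"
  using ideal_gen.add[of "x - x'" R "y - y'"] by (simp add: algebra_simps)

lemma ideal_gen_cong_mult:
  assumes "x - x' \<in> ideal_gen R" "y - y' \<in> ideal_gen R"
  shows "x * y - x' * y' \<in> ideal_gen R"
proof -
  have "x * y - x' * y' = 1 * (x - x') * y + x' * (y - y') * 1"
    by (simp add: algebra_simps)
  then show ?thesis
    using assms by (metis ideal_gen.add ideal_gen_mult)
qed

definition lin_ext :: "('k::field \<Rightarrow> 'm \<Rightarrow> 'm) \<Rightarrow> ('w \<Rightarrow> 'm) \<Rightarrow> ('w \<Rightarrow>\<^sub>0 'k) \<Rightarrow> 'm::ab_group_add"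
  where "lin_ext s f x = (\<Sum>w\<in>Poly_Mapping.keys x. s (Poly_Mapping.lookup x w) (f w))"

lemma lin_ext_superset:
  assumes "module s" "finite S" "Poly_Mapping.keys x \<subseteq> S"
  shows "lin_ext s f x = (\<Sum>w\<in>S. s (Poly_Mapping.lookup x w) (f w))"
  unfolding lin_ext_def using assms
  by (intro sum.mono_neutral_left) (auto simp: in_keys_iff module.scale_zero_left)

lemma lin_ext_zero [simp]: "lin_ext s f 0 = 0"
  by (simp add: lin_ext_def)

lemma lin_ext_add:
  assumes "module s"
  shows "lin_ext s f (x + y) = lin_ext s f x + lin_ext s f y"
proof -
  let ?S = "Poly_Mapping.keys x \<union> Poly_Mapping.keys y"
  have *: "finite ?S" "Poly_Mapping.keys (x + y) \<subseteq> ?S" "Poly_Mapping.keys x \<subseteq> ?S" "Poly_Mapping.keys y \<subseteq> ?S"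
    using keys_add[of x y] by auto
  show ?thesis
    unfolding lin_ext_superset[OF assms *(1,2)] lin_ext_superset[OF assms *(1,3)]
      lin_ext_superset[OF assms *(1,4)]
    by (simp add: lookup_add module.scale_left_distrib[OF assms] sum.distrib)
qed

lemma lin_ext_single:
  assumes "module s"
  shows "lin_ext s f (Poly_Mapping.single w c) = s c (f w)"
  by (simp add: lin_ext_def module.scale_zero_left[OF assms])

lemma lin_ext_uminus:
  assumes "module s"
  shows "lin_ext s f (- x) = - lin_ext s f x"
  using lin_ext_add[OF assms, of f x "- x"] by (simp add: eq_neg_iff_add_eq_0 add.commute)

lemma lin_ext_diff:
  assumes "module s"
  shows "lin_ext s f (x - y) = lin_ext s f x - lin_ext s f y"
  using lin_ext_add[OF assms, of f x "- y"] lin_ext_uminus[OF assms, of f y] by simp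

lemma pm_sum_single: "x = (\<Sum>w\<in>Poly_Mapping.keys x. Poly_Mapping.single w (Poly_Mapping.lookup x w))"
proof (rule poly_mapping_eqI)
  fix k
  show "Poly_Mapping.lookup x k = Poly_Mapping.lookup (\<Sum>w\<in>Poly_Mapping.keys x. Poly_Mapping.single w (Poly_Mapping.lookup x w)) k"
    by (simp add: lookup_sum lookup_single when_def in_keys_iff)
qed

lemma pm_single_induct [case_names zero single add]:
  assumes "P 0" "\<And>w c. P (Poly_Mapping.single w c)" "\<And>x y. P x \<Longrightarrow> P y \<Longrightarrow> P (x + y)"
  shows "P (x :: 'w \<Rightarrow>\<^sub>0 'k::comm_monoid_add)"
proof -
  have "P (\<Sum>w\<in>S. Poly_Mapping.single w (Poly_Mapping.lookup x w))" if "finite S" for S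
    using that by (induction S rule: finite_induct) (auto intro: assms)
  then show ?thesis using pm_sum_single[of x] by (metis finite_keys)
qed

lemma lin_ext_mult:
  fixes f :: "'w::monoid_add \<Rightarrow> 'm::ring_1"
  assumes s: "module s" and f: "\<And>u v. f (u + v) = f u * f v"
    and s1: "\<And>c x y. s c (x * y) = s c x * y" and s2: "\<And>c x y. s c (x * y) = x * s c y"
  shows "lin_ext s f (x * y) = lin_ext s f x * lin_ext s f y"
proof (induction x rule: pm_single_induct)
  case zero
  then show ?case by simp
next
  case (single u c)
  show ?case
  proof (induction y rule: pm_single_induct)
    case zero
    then show ?case by simp
  next
    case (single v e)
    have "s (c * e) (f u * f v) = s c (f u) * s e (f v)"
      by (metis module.scale_scale[OF s] s1 s2)
    then show ?case by (simp add: mult_single lin_ext_single[OF s] f)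
  next
    case (add y z)
    then show ?case by (simp add: distrib_left lin_ext_add[OF s])
  qed
next
  case (add x z)
  then show ?case by (simp add: distrib_right lin_ext_add[OF s])
qed

lemma lin_ext_ideal:
  fixes f :: "'w::monoid_add \<Rightarrow> 'm::ring_1"
  assumes s: "module s" and f: "\<And>u v. f (u + v) = f u * f v"
    and s1: "\<And>c x y. s c (x * y) = s c x * y" and s2: "\<And>c x y. s c (x * y) = x * s c y"
    and R: "\<And>r. r \<in> R \<Longrightarrow> lin_ext s f r = 0"
    and x: "x \<in> ideal_gen R"
  shows "lin_ext s f x = 0"
  using x
  by (induction rule: ideal_gen.induct)
     (simp_all add: lin_ext_mult[OF s f s1 s2] R lin_ext_add[OF s])


section \<open>The algebra $D_4$\<close>

datatype gen = Ga | Gb | Gc | Gd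

text \<open>The free monoid on the generators, written additively because the product of
  \<^typ>\<open>'w \<Rightarrow>\<^sub>0 'k\<close> is the convolution over an additive monoid \<^typ>\<open>'w\<close>.  With this structure
  \<open>word \<Rightarrow>\<^sub>0 'k\<close> is the free algebra on \<open>Ga, Gb, Gc, Gd\<close>.\<close>

datatype word = Word (letters: "gen list")

instantiation word :: monoid_add
begin
definition "0 = Word []"
definition "u + v = Word (letters u @ letters v)"
instance by standard (auto simp: zero_word_def plus_word_def)
end

lemma letters_word [simp]: "letters 0 = []" "letters (u + v) = letters u @ letters v"
  by (simp_all add: zero_word_def plus_word_def)

abbreviation free_gen :: "gen \<Rightarrow> (word \<Rightarrow>\<^sub>0 'k::field)"
  where "free_gen g \<equiv> Poly_Mapping.single (Word [g]) 1"

definition D4_relators :: "(word \<Rightarrow>\<^sub>0 'k::field) set" where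
  "D4_relators =
    (let a = free_gen Ga; b = free_gen Gb; c = free_gen Gc; d = free_gen Gd in
      {b * a - (- (a * b)), d * b - (- (b * d)), c * a - (- (a * c)), d * c - (- (c * d)),
       b * c - c * b, a * a - 0, b * b - 1, c * c - 1, d * d - 0, d * a + a * d - (1 - b * c)})"

quotient_type (overloaded) 'k D4 = "word \<Rightarrow>\<^sub>0 'k::field" /
    "\<lambda>x y. x - y \<in> ideal_gen (D4_relators :: (word \<Rightarrow>\<^sub>0 'k) set)"
  by (rule ideal_gen_equivp)

lemma module_times: "module ((*) :: 'k::field \<Rightarrow> 'k \<Rightarrow> 'k)"
  by unfold_locales (simp_all add: algebra_simps)

fun counit_gen :: "gen \<Rightarrow> 'k::field" where
  "counit_gen Ga = 0" | "counit_gen Gb = 1" | "counit_gen Gc = 1" | "counit_gen Gd = 0"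

definition free_counit :: "(word \<Rightarrow>\<^sub>0 'k::field) \<Rightarrow> 'k" where
  "free_counit = lin_ext (*) (\<lambda>w. prod_list (map counit_gen (letters w)))"

lemma free_counit_simps:
  "free_counit (x + y) = free_counit x + free_counit y"
  "free_counit (x - y) = free_counit x - free_counit y"
  "free_counit (- x) = - free_counit x"
  "free_counit (x * y) = free_counit x * free_counit y"
  "free_counit 0 = 0"
  "free_counit (Poly_Mapping.single w e) = e * prod_list (map counit_gen (letters w))"
  unfolding free_counit_def
  by (simp_all add: lin_ext_add lin_ext_diff lin_ext_uminus lin_ext_single lin_ext_mult module_times)

lemma free_counit_1: "free_counit 1 = 1"
  unfolding single_one[symmetric] by (simp only: free_counit_simps) simp

lemma free_counit_ideal: "x \<in> ideal_gen D4_relators \<Longrightarrow> free_counit x = 0"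
  by (induction rule: ideal_gen.induct)
     (auto simp: free_counit_simps free_counit_1 D4_relators_def Let_def)

instantiation D4 :: (field) ring_1
begin
lift_definition zero_D4 :: "'a D4" is 0 .
lift_definition one_D4 :: "'a D4" is 1 .
lift_definition plus_D4 :: "'a D4 \<Rightarrow> 'a D4 \<Rightarrow> 'a D4" is "(+)"
  by (rule ideal_gen_cong_add)
lift_definition uminus_D4 :: "'a D4 \<Rightarrow> 'a D4" is uminus
  using ideal_gen_uminus by fastforce
lift_definition minus_D4 :: "'a D4 \<Rightarrow> 'a D4 \<Rightarrow> 'a D4" is "(-)"
  subgoal for x x' y y'
    using ideal_gen_cong_add[of x x' D4_relators "- y" "- y'"]
      ideal_gen_uminus[of "y - y'" D4_relators] by simp
  done
lift_definition times_D4 :: "'a D4 \<Rightarrow> 'a D4 \<Rightarrow> 'a D4" is "(*)"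
  by (rule ideal_gen_cong_mult)
instance
proof
  show "(0::'a D4) \<noteq> 1"
    by transfer (auto dest: free_counit_ideal simp: free_counit_simps free_counit_1)
qed (transfer; simp add: algebra_simps ideal_gen.zero)+
end

lift_definition D4_gen :: "gen \<Rightarrow> 'k::field D4" is free_gen .

abbreviation "D4a \<equiv> D4_gen Ga"
abbreviation "D4b \<equiv> D4_gen Gb"
abbreviation "D4c \<equiv> D4_gen Gc"
abbreviation "D4d \<equiv> D4_gen Gd"

lift_definition D4_of :: "'k::field \<Rightarrow> 'k D4" is "Poly_Mapping.single 0" .

lemma D4_relations:
  "D4b * D4a = - (D4a * D4b)" "D4d * D4b = - (D4b * D4d)"
  "D4c * D4a = - (D4a * D4c)" "D4d * D4c = - (D4c * D4d)"
  "D4b * D4c = D4c * D4b" "D4a * D4a = 0" "D4b * D4b = 1" "D4c * D4c = 1" "D4d * D4d = 0"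
  "D4d * D4a + D4a * D4d = 1 - D4b * D4c"
  by (transfer, rule ideal_gen_base, simp only: D4_relators_def Let_def insert_iff simp_thms)+

lemma D4_of_simps:
  "D4_of 0 = 0" "D4_of 1 = 1" "D4_of (p + q) = D4_of p + D4_of q" "D4_of (p * q) = D4_of p * D4_of q"
  by (transfer; simp add: ideal_gen.zero single_add mult_single)+

lemma pm_single_zero_commute:
  "Poly_Mapping.single 0 c * x = x * Poly_Mapping.single (0::'w::monoid_add) (c :: 'k::field)"
  by (induction x rule: pm_single_induct) (simp_all add: algebra_simps mult_single)

lemma D4_of_commute: "D4_of c * x = x * D4_of c"
  by transfer (simp add: pm_single_zero_commute ideal_gen.zero)

lift_definition D4_counit :: "'k::field D4 \<Rightarrow> 'k" is free_counit
  using free_counit_ideal by (fastforce simp: free_counit_simps)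


section \<open>The algebra $D_4 \otimes D_4$ and the comultiplication\<close>

text \<open>\<open>('a, 'b) mpair\<close> is the product of two multiplicative monoids, again written additively, so
  \<open>('k D4, 'k D4) mpair \<Rightarrow>\<^sub>0 'k\<close> is the vector space with basis \<open>D\<^sub>4 \<times> D\<^sub>4\<close> and product
  \<open>(x, y) (x', y') = (x x', y y')\<close>.  Dividing by bilinearity gives the algebra \<open>D\<^sub>4 \<otimes> D\<^sub>4\<close>.\<close>

datatype ('a, 'b) mpair = MPair (left: 'a) (right: 'b)

instantiation mpair :: (monoid_mult, monoid_mult) monoid_add
begin
definition "0 = MPair 1 1"
definition "u + v = MPair (left u * left v) (right u * right v)"
instance by standard (auto simp: zero_mpair_def plus_mpair_def mult.assoc)
end

lemma mpair_simps [simp]: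
  "left 0 = 1" "right 0 = 1" "left (u + v) = left u * left v" "right (u + v) = right u * right v"
  "MPair x y + MPair x' y' = MPair (x * x') (y * y')"
  by (simp_all add: zero_mpair_def plus_mpair_def)

type_synonym 'k free_sq = "('k D4, 'k D4) mpair \<Rightarrow>\<^sub>0 'k"

abbreviation free_tens :: "'k::field D4 \<Rightarrow> 'k D4 \<Rightarrow> 'k free_sq"
  where "free_tens x y \<equiv> Poly_Mapping.single (MPair x y) 1"

definition bilinear_relators :: "'k::field free_sq set" where
  "bilinear_relators =
     {free_tens (x + x') y - (free_tens x y + free_tens x' y) | x x' y. True} \<union>
     {free_tens x (y + y') - (free_tens x y + free_tens x y') | x y y'. True} \<union>
     {free_tens (D4_of c * x) y - Poly_Mapping.single 0 c * free_tens x y | c x y. True} \<union>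
     {free_tens x (D4_of c * y) - Poly_Mapping.single 0 c * free_tens x y | c x y. True}"

quotient_type (overloaded) 'k D4_sq = "'k::field free_sq" /
    "\<lambda>x y. x - y \<in> ideal_gen (bilinear_relators :: 'k free_sq set)"
  by (rule ideal_gen_equivp)

lemma D4_counit_simps:
  "D4_counit (x + y) = D4_counit x + D4_counit y"
  "D4_counit (x * y) = D4_counit x * D4_counit y"
  "D4_counit 1 = 1" "D4_counit (D4_of c) = c"
  by (transfer; simp add: free_counit_simps free_counit_1)+

lemma counit_sq_relators:
  assumes "r \<in> bilinear_relators"
  shows "lin_ext (*) (\<lambda>p. D4_counit (left p) * D4_counit (right p)) r = 0"
  using assms unfolding bilinear_relators_def
  by (elim UnE CollectE exE conjE; hypsubst)
     (simp_all add: lin_ext_add lin_ext_diff lin_ext_single module_times D4_counit_simps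
        mult_single distrib_left distrib_right)

lemma counit_sq_ideal:
  "x \<in> ideal_gen bilinear_relators \<Longrightarrow>
     lin_ext (*) (\<lambda>p. D4_counit (left p) * D4_counit (right p)) x = 0"
  by (rule lin_ext_ideal[OF module_times, where R = bilinear_relators])
     (simp_all add: D4_counit_simps counit_sq_relators)

instantiation D4_sq :: (field) ring_1
begin
lift_definition zero_D4_sq :: "'a D4_sq" is 0 .
lift_definition one_D4_sq :: "'a D4_sq" is 1 .
lift_definition plus_D4_sq :: "'a D4_sq \<Rightarrow> 'a D4_sq \<Rightarrow> 'a D4_sq" is "(+)"
  by (rule ideal_gen_cong_add)
lift_definition uminus_D4_sq :: "'a D4_sq \<Rightarrow> 'a D4_sq" is uminus
  using ideal_gen_uminus by fastforce
lift_definition minus_D4_sq :: "'a D4_sq \<Rightarrow> 'a D4_sq \<Rightarrow> 'a D4_sq" is "(-)"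
  subgoal for x x' y y'
    using ideal_gen_cong_add[of x x' bilinear_relators "- y" "- y'"]
      ideal_gen_uminus[of "y - y'" bilinear_relators] by simp
  done
lift_definition times_D4_sq :: "'a D4_sq \<Rightarrow> 'a D4_sq \<Rightarrow> 'a D4_sq" is "(*)"
  by (rule ideal_gen_cong_mult)
instance
proof
  have "lin_ext (*) (\<lambda>p. D4_counit (left p) * D4_counit (right p)) (1 :: 'a free_sq) = 1"
    unfolding single_one[symmetric] by (simp only: lin_ext_single module_times) (simp add: D4_counit_simps)
  then have "(1 :: 'a free_sq) \<notin> ideal_gen bilinear_relators"
    using counit_sq_ideal[of "1 :: 'a free_sq"] by auto
  then have "0 - (1 :: 'a free_sq) \<notin> ideal_gen bilinear_relators"
    using ideal_gen_uminus[of "0 - (1 :: 'a free_sq)" bilinear_relators] by auto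
  then show "(0::'a D4_sq) \<noteq> 1"
    by transfer
qed (transfer; simp add: algebra_simps ideal_gen.zero)+
end

lift_definition tens :: "'k::field D4 \<Rightarrow> 'k D4 \<Rightarrow> 'k D4_sq" (infix \<open>\<otimes>\<close> 72) is
  "free_tens" .

lift_definition D4_sq_scale :: "'k::field \<Rightarrow> 'k D4_sq \<Rightarrow> 'k D4_sq" is
  "\<lambda>c x. Poly_Mapping.single 0 c * x"
  by (rule ideal_gen_cong_mult) (simp_all add: ideal_gen.zero)

lemma tens_simps:
  "(x + x') \<otimes> y = x \<otimes> y + x' \<otimes> y" "x \<otimes> (y + y') = x \<otimes> y + x \<otimes> y'"
  "(D4_of c * x) \<otimes> y = D4_sq_scale c (x \<otimes> y)" "x \<otimes> (D4_of c * y) = D4_sq_scale c (x \<otimes> y)"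
  by (transfer, rule ideal_gen_base, unfold bilinear_relators_def, blast)+

lemma tens_mult: "(x \<otimes> y) * (x' \<otimes> y') = (x * x') \<otimes> (y * y')"
  by transfer (simp add: mult_single ideal_gen.zero)

lemma tens_one: "1 \<otimes> 1 = 1"
  by transfer (simp add: zero_mpair_def[symmetric] ideal_gen.zero)

lemma tens_zero: "0 \<otimes> y = 0" "x \<otimes> 0 = 0"
  using tens_simps(1)[of 0 0 y] tens_simps(2)[of x 0 0] by simp_all

lemma tens_minus: "(- x) \<otimes> y = - (x \<otimes> y)" "x \<otimes> (- y) = - (x \<otimes> y)"
  using tens_simps(1)[of "- x" x y] tens_simps(2)[of x "- y" y]
  by (simp_all add: tens_zero eq_neg_iff_add_eq_0)

lemma tens_diff: "(x - x') \<otimes> y = x \<otimes> y - x' \<otimes> y" "x \<otimes> (y - y') = x \<otimes> y - x \<otimes> y'"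
  using tens_simps(1)[of x "- x'" y] tens_simps(2)[of x y "- y'"] by (simp_all add: tens_minus)

lemma module_D4_sq_scale: "module D4_sq_scale"
  by (unfold_locales; transfer)
     (simp_all add: algebra_simps single_add ideal_gen.zero mult_single flip: mult.assoc)

lemma D4_sq_scale_mult:
  "D4_sq_scale c (x * y) = D4_sq_scale c x * y" "D4_sq_scale c (x * y) = x * D4_sq_scale c y"
  by (transfer, simp add: mult.assoc ideal_gen.zero)
     (transfer, simp add: pm_single_zero_commute mult.assoc ideal_gen.zero)

fun comult_gen :: "gen \<Rightarrow> 'k::field D4_sq" where
  "comult_gen Ga = D4a \<otimes> D4b + 1 \<otimes> D4a"
| "comult_gen Gb = D4b \<otimes> D4b"
| "comult_gen Gc = D4c \<otimes> D4c"
| "comult_gen Gd = D4d \<otimes> D4c + 1 \<otimes> D4d"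

definition free_comult :: "(word \<Rightarrow>\<^sub>0 'k::field) \<Rightarrow> 'k D4_sq" where
  "free_comult = lin_ext D4_sq_scale (\<lambda>w. prod_list (map comult_gen (letters w)))"

lemma free_comult_simps:
  "free_comult (x + y) = free_comult x + free_comult y"
  "free_comult (x - y) = free_comult x - free_comult y"
  "free_comult (- x) = - free_comult x"
  "free_comult (x * y) = free_comult x * free_comult y"
  "free_comult 0 = 0"
  "free_comult (Poly_Mapping.single w e) = D4_sq_scale e (prod_list (map comult_gen (letters w)))"
  unfolding free_comult_def
  by (simp_all add: lin_ext_add lin_ext_diff lin_ext_uminus lin_ext_single module_D4_sq_scale)
     (rule lin_ext_mult, simp_all add: module_D4_sq_scale D4_sq_scale_mult[symmetric])

lemma free_comult_1: "free_comult 1 = 1"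
  unfolding single_one[symmetric]
  by (simp only: free_comult_simps) (simp add: module.scale_one[OF module_D4_sq_scale])

lemma free_comult_gen: "free_comult (free_gen g) = comult_gen g"
  by (simp add: free_comult_simps module.scale_one[OF module_D4_sq_scale])

lemma comult_gen_relations:
  "comult_gen Gb * comult_gen Ga = - (comult_gen Ga * comult_gen Gb)"
  "comult_gen Gd * comult_gen Gb = - (comult_gen Gb * comult_gen Gd)"
  "comult_gen Gc * comult_gen Ga = - (comult_gen Ga * comult_gen Gc)"
  "comult_gen Gd * comult_gen Gc = - (comult_gen Gc * comult_gen Gd)"
  "comult_gen Gb * comult_gen Gc = comult_gen Gc * comult_gen Gb"
  "comult_gen Ga * comult_gen Ga = 0" "comult_gen Gb * comult_gen Gb = 1"
  "comult_gen Gc * comult_gen Gc = 1" "comult_gen Gd * comult_gen Gd = 0"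
  "comult_gen Gd * comult_gen Ga + comult_gen Ga * comult_gen Gd = 1 - comult_gen Gb * comult_gen Gc"
proof -
  note R = D4_relations
  have ad: "D4d * D4a = 1 - D4b * D4c - D4a * D4d"
    using R(10) by (simp add: algebra_simps)
  note S = distrib_left distrib_right tens_mult tens_simps(1,2) tens_minus tens_zero tens_one
  show "comult_gen Gb * comult_gen Ga = - (comult_gen Ga * comult_gen Gb)"
    by (simp add: S R)
  show "comult_gen Gd * comult_gen Gb = - (comult_gen Gb * comult_gen Gd)"
    by (simp add: S R)
  show "comult_gen Gc * comult_gen Ga = - (comult_gen Ga * comult_gen Gc)"
    by (simp add: S R)
  show "comult_gen Gd * comult_gen Gc = - (comult_gen Gc * comult_gen Gd)"
    by (simp add: S R)
  show "comult_gen Gb * comult_gen Gc = comult_gen Gc * comult_gen Gb"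
    by (simp add: S R)
  show "comult_gen Ga * comult_gen Ga = 0" "comult_gen Gb * comult_gen Gb = 1"
    "comult_gen Gc * comult_gen Gc = 1" "comult_gen Gd * comult_gen Gd = 0"
    by (simp_all add: S R)
  show "comult_gen Gd * comult_gen Ga + comult_gen Ga * comult_gen Gd
      = 1 - comult_gen Gb * comult_gen Gc"
    by (simp add: S R ad tens_diff)
qed

lemma free_comult_ideal:
  assumes "x \<in> ideal_gen D4_relators"
  shows "free_comult x = 0"
proof -
  have R: "free_comult r = 0" if "r \<in> D4_relators" for r :: "word \<Rightarrow>\<^sub>0 'a"
    using that unfolding D4_relators_def Let_def
    by (auto simp only: free_comult_simps(1-5) free_comult_1 free_comult_gen comult_gen_relations
        insert_iff empty_iff diff_self minus_minus add.right_inverse add.left_inverse)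
  show ?thesis
    using assms by (induction rule: ideal_gen.induct) (simp_all add: free_comult_simps R)
qed

lift_definition D4_comult :: "'k::field D4 \<Rightarrow> 'k D4_sq" is free_comult
  using free_comult_ideal by (fastforce simp: free_comult_simps)

lemma D4_comult_simps:
  "D4_comult (x + y) = D4_comult x + D4_comult y"
  "D4_comult (x * y) = D4_comult x * D4_comult y"
  "D4_comult 1 = 1" "D4_comult (D4_of c) = D4_sq_scale c 1"
  by (transfer; simp add: free_comult_simps free_comult_1)+

lemma D4_comult_gen: "D4_comult (D4_gen g) = comult_gen g"
  by transfer (rule free_comult_gen)


section \<open>Modules\<close>

definition D4_module :: "('k::field D4 \<Rightarrow> 'k ^ 'i \<Rightarrow> 'k ^ 'i::finite) \<Rightarrow> bool" where
  "D4_module \<rho> \<longleftrightarrow>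
     (\<forall>h. Vector_Spaces.linear (*s) (*s) (\<rho> h)) \<and>
     (\<forall>g h v. \<rho> (g + h) v = \<rho> g v + \<rho> h v) \<and>
     (\<forall>c v. \<rho> (D4_of c) v = c *s v) \<and>
     (\<forall>v. \<rho> 1 v = v) \<and>
     (\<forall>g h v. \<rho> (g * h) v = \<rho> g (\<rho> h v))"

definition D4_iso :: "('k::field D4 \<Rightarrow> 'k ^ 'i \<Rightarrow> 'k ^ 'i::finite) \<Rightarrow>
    ('k D4 \<Rightarrow> 'k ^ 'j \<Rightarrow> 'k ^ 'j::finite) \<Rightarrow> bool" (infix \<open>\<cong>\<close> 50) where
  "\<rho> \<cong> \<sigma> \<longleftrightarrow> D4_module \<rho> \<and> D4_module \<sigma> \<and>
     (\<exists>f. Vector_Spaces.linear (*s) (*s) f \<and> bij f \<and> (\<forall>h v. f (\<rho> h v) = \<sigma> h (f v)))"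

definition direct_sum :: "('k::field D4 \<Rightarrow> 'k ^ 'i \<Rightarrow> 'k ^ 'i::finite) \<Rightarrow>
    ('k D4 \<Rightarrow> 'k ^ 'j \<Rightarrow> 'k ^ 'j::finite) \<Rightarrow>
    'k D4 \<Rightarrow> 'k ^ ('i + 'j) \<Rightarrow> 'k ^ ('i + 'j)" (infixr \<open>\<oplus>\<close> 65) where
  "(\<rho> \<oplus> \<sigma>) h v = (\<chi> s. case s of
      Inl i \<Rightarrow> \<rho> h (\<chi> i. v $ Inl i) $ i
    | Inr j \<Rightarrow> \<sigma> h (\<chi> j. v $ Inr j) $ j)"

text \<open>\<open>'k ^ ('i \<times> 'j)\<close> serves as the tensor product of \<open>'k ^ 'i\<close> and \<open>'k ^ 'j\<close>.\<close>

definition tensor_vec :: "'k::field ^ 'i \<Rightarrow> 'k ^ 'j \<Rightarrow> 'k ^ ('i::finite \<times> 'j::finite)" where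
  "tensor_vec v w = (\<chi> p. v $ fst p * w $ snd p)"

definition tensor_map :: "('k::field ^ 'i \<Rightarrow> 'k ^ 'i) \<Rightarrow> ('k ^ 'j \<Rightarrow> 'k ^ 'j) \<Rightarrow>
    'k ^ ('i::finite \<times> 'j::finite) \<Rightarrow> 'k ^ ('i \<times> 'j)" where
  "tensor_map f g t =
     (\<Sum>p\<in>UNIV. t $ p *s tensor_vec (f (axis (fst p) 1)) (g (axis (snd p) 1)))"

text \<open>The action of \<open>D\<^sub>4 \<otimes> D\<^sub>4\<close> on a tensor product, \<open>(x \<otimes> y) (v \<otimes> w) = x v \<otimes> y w\<close>.  For modules
  \<open>\<rho>\<close> and \<open>\<sigma>\<close> it does not depend on the representative of \<open>z\<close>; see \<open>D4_sq_act_tens\<close>.\<close>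

definition D4_sq_act :: "('k::field D4 \<Rightarrow> 'k ^ 'i \<Rightarrow> 'k ^ 'i::finite) \<Rightarrow>
    ('k D4 \<Rightarrow> 'k ^ 'j \<Rightarrow> 'k ^ 'j::finite) \<Rightarrow>
    'k D4_sq \<Rightarrow> 'k ^ ('i \<times> 'j) \<Rightarrow> 'k ^ ('i \<times> 'j)" where
  "D4_sq_act \<rho> \<sigma> z t =
     lin_ext (*s) (\<lambda>p. tensor_map (\<rho> (left p)) (\<sigma> (right p)) t) (rep_D4_sq z)"

definition tensor_mod :: "('k::field D4 \<Rightarrow> 'k ^ 'i \<Rightarrow> 'k ^ 'i::finite) \<Rightarrow>
    ('k D4 \<Rightarrow> 'k ^ 'j \<Rightarrow> 'k ^ 'j::finite) \<Rightarrow>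
    'k D4 \<Rightarrow> 'k ^ ('i \<times> 'j) \<Rightarrow> 'k ^ ('i \<times> 'j)" (infixr \<open>\<otimes>\<^sub>m\<close> 70) where
  "(\<rho> \<otimes>\<^sub>m \<sigma>) h = D4_sq_act \<rho> \<sigma> (D4_comult h)"

lemma linear_tensor_map: "Vector_Spaces.linear (*s) (*s) (tensor_map f g)"
  by (unfold_locales)
     (simp_all add: tensor_map_def vec.scale_left_distrib sum.distrib vec.scale_sum_right)

lemma tensor_vec_axis: "tensor_vec (axis i 1) (axis j 1) = axis (i, j) 1"
  by (auto simp: tensor_vec_def axis_def vec_eq_iff)

lemma tensor_vec_bilinear:
  "tensor_vec (v + v') w = tensor_vec v w + tensor_vec v' w"
  "tensor_vec v (w + w') = tensor_vec v w + tensor_vec v w'"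
  "tensor_vec (c *s v) w = c *s tensor_vec v w"
  "tensor_vec v (c *s w) = c *s tensor_vec v w"
  by (simp_all add: tensor_vec_def vec_eq_iff algebra_simps)

lemma tensor_vec_sum:
  "tensor_vec (\<Sum>i\<in>A. f i) w = (\<Sum>i\<in>A. tensor_vec (f i) w)"
  "tensor_vec v (\<Sum>j\<in>B. g j) = (\<Sum>j\<in>B. tensor_vec v (g j))"
  by (simp_all add: tensor_vec_def vec_eq_iff sum_distrib_left sum_distrib_right)

lemma linear_axis_expansion:
  assumes "Vector_Spaces.linear (*s) (*s) f"
  shows "f v = (\<Sum>i\<in>UNIV. v $ i *s f (axis i 1))"
proof -
  interpret Vector_Spaces.linear "(*s)" "(*s)" f by fact
  show ?thesis
    by (subst basis_expansion[symmetric]) (simp add: sum scale)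
qed

lemma tensor_map_tensor_vec:
  assumes "Vector_Spaces.linear (*s) (*s) f" "Vector_Spaces.linear (*s) (*s) g"
  shows "tensor_map f g (tensor_vec v w) = tensor_vec (f v) (g w)"
proof -
  have "tensor_vec (f v) (g w) =
      (\<Sum>i\<in>UNIV. \<Sum>j\<in>UNIV. (v $ i * w $ j) *s tensor_vec (f (axis i 1)) (g (axis j 1)))"
    by (subst linear_axis_expansion[OF assms(1), of v], subst linear_axis_expansion[OF assms(2), of w])
       (simp add: tensor_vec_sum tensor_vec_bilinear mult.commute vec.scale_sum_right,
        rule sum.swap)
  also have "\<dots> = tensor_map f g (tensor_vec v w)"
    unfolding tensor_map_def
    by (simp add: sum.cartesian_product tensor_vec_def[of v w] split_def flip: UNIV_Times_UNIV)
  finally show ?thesis ..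
qed

lemma linear_tensor_ext:
  assumes "Vector_Spaces.linear (*s) (*s) F" "Vector_Spaces.linear (*s) (*s) G"
    and "\<And>v w. F (tensor_vec v w) = G (tensor_vec v w)"
  shows "F t = G t"
proof -
  have "F (axis p 1) = G (axis p 1)" for p
    using assms(3)[of "axis (fst p) 1" "axis (snd p) 1"] by (simp add: tensor_vec_axis)
  then show ?thesis
    using linear_axis_expansion[OF assms(1), of t] linear_axis_expansion[OF assms(2), of t] by simp
qed

lemma linear_comp:
  fixes p :: "'x::field ^ 'c \<Rightarrow> 'x ^ 'e" and q :: "'x ^ 'b \<Rightarrow> 'x ^ 'c"
  assumes "Vector_Spaces.linear (*s) (*s) p" "Vector_Spaces.linear (*s) (*s) q"
  shows "Vector_Spaces.linear (*s) (*s) (\<lambda>x. p (q x))"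
  using Vector_Spaces.linear_compose[OF assms(2,1)] by (simp add: o_def)

lemma tensor_map_comp:
  assumes "Vector_Spaces.linear (*s) (*s) f" "Vector_Spaces.linear (*s) (*s) g"
    "Vector_Spaces.linear (*s) (*s) f'" "Vector_Spaces.linear (*s) (*s) g'"
  shows "tensor_map f g (tensor_map f' g' t) = tensor_map (\<lambda>v. f (f' v)) (\<lambda>w. g (g' w)) t"
proof (rule linear_tensor_ext[where F = "\<lambda>t. tensor_map f g (tensor_map f' g' t)"])
  show "Vector_Spaces.linear (*s) (*s) (\<lambda>t. tensor_map f g (tensor_map f' g' t))"
    by (rule linear_comp[OF linear_tensor_map linear_tensor_map])
  show "Vector_Spaces.linear (*s) (*s) (tensor_map (\<lambda>v. f (f' v)) (\<lambda>w. g (g' w)))"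
    by (rule linear_tensor_map)
  show "tensor_map f g (tensor_map f' g' (tensor_vec v w))
      = tensor_map (\<lambda>v. f (f' v)) (\<lambda>w. g (g' w)) (tensor_vec v w)" for v w
    by (simp add: tensor_map_tensor_vec assms linear_comp[OF assms(1,3)] linear_comp[OF assms(2,4)])
qed

lemma D4_moduleD:
  assumes "D4_module \<rho>"
  shows "Vector_Spaces.linear (*s) (*s) (\<rho> h)"
    and "\<rho> (g + h) v = \<rho> g v + \<rho> h v" and "\<rho> (D4_of c) v = c *s v" and "\<rho> 1 v = v"
    and "\<rho> (g * h) v = \<rho> g (\<rho> h v)"
  using assms by (simp_all add: D4_module_def)

context
  fixes \<rho> :: "'k::field D4 \<Rightarrow> 'k ^ 'i \<Rightarrow> 'k ^ 'i::finite"
    and \<sigma> :: "'k D4 \<Rightarrow> 'k ^ 'j \<Rightarrow> 'k ^ 'j::finite"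
  assumes \<rho>: "D4_module \<rho>" and \<sigma>: "D4_module \<sigma>"
begin

private definition act where
  "act z t = lin_ext (*s) (\<lambda>p. tensor_map (\<rho> (left p)) (\<sigma> (right p)) t) z"

private lemmas ml = vec.module_axioms

private lemma act_linear: "Vector_Spaces.linear (*s) (*s) (act z)"
proof (induction z rule: pm_single_induct)
  case zero
  then show ?case by unfold_locales (simp_all add: act_def)
next
  case (single w c)
  interpret Vector_Spaces.linear "(*s)" "(*s)" "tensor_map (\<rho> (left w)) (\<sigma> (right w))"
    by (rule linear_tensor_map)
  show ?case
    by unfold_locales (simp_all add: act_def lin_ext_single[OF ml] add scale vec.scale_right_distrib
      vec.scale_left_commute)
next
  case (add x y)
  interpret x: Vector_Spaces.linear "(*s)" "(*s)" "act x" by (rule add)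
  interpret y: Vector_Spaces.linear "(*s)" "(*s)" "act y" by (rule add)
  have "act (x + y) = (\<lambda>t. act x t + act y t)"
    by (simp add: act_def lin_ext_add[OF ml] fun_eq_iff)
  then show ?case
    by unfold_locales (simp_all add: x.add y.add x.scale y.scale vec.scale_right_distrib)
qed

private lemma act_add: "act (x + y) t = act x t + act y t"
  by (simp add: act_def lin_ext_add[OF ml])

private lemma act_diff: "act (x - y) t = act x t - act y t"
  by (simp add: act_def lin_ext_diff[OF ml])

private lemma act_single: "act (Poly_Mapping.single w c) t =
    c *s tensor_map (\<rho> (left w)) (\<sigma> (right w)) t"
  by (simp add: act_def lin_ext_single[OF ml])

private lemma act_mult: "act (x * y) t = act x (act y t)"
proof (induction x rule: pm_single_induct)
  case zero
  then show ?case by (simp add: act_def)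
next
  case (single u c)
  interpret Vector_Spaces.linear "(*s)" "(*s)" "act (Poly_Mapping.single u c)" by (rule act_linear)
  have add': "act (Poly_Mapping.single u c) (x + y) =
      act (Poly_Mapping.single u c) x + act (Poly_Mapping.single u c) y" for x y
    by (rule add)
  have act_0: "act (Poly_Mapping.single u c) 0 = 0" by (rule zero)
  show ?case
  proof (induction y rule: pm_single_induct)
    case zero
    then show ?case using act_0 by (simp add: act_def)
  next
    case (single v e)
    have "act (Poly_Mapping.single u c * Poly_Mapping.single v e) t
        = (c * e) *s tensor_map (\<lambda>x. \<rho> (left u) (\<rho> (left v) x)) (\<lambda>x. \<sigma> (right u) (\<sigma> (right v) x)) t"
      by (simp add: mult_single act_single D4_moduleD(5)[OF \<rho>, abs_def] D4_moduleD(5)[OF \<sigma>, abs_def])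
    also have "\<dots> = (c * e) *s tensor_map (\<rho> (left u)) (\<sigma> (right u))
        (tensor_map (\<rho> (left v)) (\<sigma> (right v)) t)"
      by (simp add: tensor_map_comp D4_moduleD(1)[OF \<rho>] D4_moduleD(1)[OF \<sigma>])
    also have "\<dots> = act (Poly_Mapping.single u c) (act (Poly_Mapping.single v e) t)"
      unfolding act_single[of v] scale by (simp add: act_single mult.commute)
    finally show ?case .
  next
    case (add y z)
    then show ?case by (simp add: distrib_left act_add add')
  qed
next
  case (add x z)
  then show ?case by (simp add: distrib_right act_add)
qed

private lemma act_relators:
  assumes "r \<in> bilinear_relators"
  shows "act r t = 0"
proof -
  have Z: "Vector_Spaces.linear (*s) (*s) (\<lambda>t :: 'k ^ ('i \<times> 'j). 0 :: 'k ^ ('i \<times> 'j))"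
    by unfold_locales simp_all
  show ?thesis
  proof (rule linear_tensor_ext[OF act_linear Z])
    show "act r (tensor_vec v w) = 0" for v w
      using assms unfolding bilinear_relators_def
      by (elim UnE CollectE exE conjE; hypsubst)
         (simp_all add: act_add act_diff act_single tensor_map_tensor_vec mult_single
          D4_moduleD(1)[OF \<rho>] D4_moduleD(1)[OF \<sigma>] D4_moduleD(2,3,5)[OF \<rho>] D4_moduleD(2,3,5)[OF \<sigma>]
          tensor_vec_bilinear)
  qed
qed

private lemma act_ideal:
  assumes "z \<in> ideal_gen bilinear_relators"
  shows "act z t = 0"
proof -
  have 0: "act x 0 = 0" for x
  proof -
    interpret Vector_Spaces.linear "(*s)" "(*s)" "act x" by (rule act_linear)
    show ?thesis by (rule zero)
  qed
  show ?thesis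
    using assms
    by (induction rule: ideal_gen.induct) (simp_all add: act_mult act_add act_relators 0, simp add: act_def)
qed

private lemma D4_sq_act_abs: "D4_sq_act \<rho> \<sigma> (abs_D4_sq z) t = act z t"
proof -
  have "abs_D4_sq (rep_D4_sq (abs_D4_sq z)) = abs_D4_sq z"
    by (rule Quotient3_abs_rep[OF Quotient3_D4_sq])
  then have "rep_D4_sq (abs_D4_sq z) - z \<in> ideal_gen bilinear_relators"
    by (simp only: D4_sq.abs_eq_iff)
  then have "act (rep_D4_sq (abs_D4_sq z) - z) t = 0"
    by (rule act_ideal)
  then have "act (rep_D4_sq (abs_D4_sq z)) t = act z t"
    by (simp add: act_diff)
  then show ?thesis by (simp add: D4_sq_act_def act_def)
qed

lemma D4_sq_act_linear: "Vector_Spaces.linear (*s) (*s) (D4_sq_act \<rho> \<sigma> z)"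
proof (induct z rule: D4_sq.abs_induct)
  case (1 y)
  have "D4_sq_act \<rho> \<sigma> (abs_D4_sq y) = act y"
    by (rule ext) (rule D4_sq_act_abs)
  then show ?case by (simp add: act_linear)
qed

lemma D4_sq_act_add: "D4_sq_act \<rho> \<sigma> (x + y) t = D4_sq_act \<rho> \<sigma> x t + D4_sq_act \<rho> \<sigma> y t"
  by (induct x rule: D4_sq.abs_induct, induct y rule: D4_sq.abs_induct)
     (simp add: plus_D4_sq.abs_eq D4_sq_act_abs act_add)

lemma D4_sq_act_mult: "D4_sq_act \<rho> \<sigma> (x * y) t = D4_sq_act \<rho> \<sigma> x (D4_sq_act \<rho> \<sigma> y t)"
  by (induct x rule: D4_sq.abs_induct, induct y rule: D4_sq.abs_induct)
     (simp add: times_D4_sq.abs_eq D4_sq_act_abs act_mult)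

lemma D4_sq_act_tens:
  "D4_sq_act \<rho> \<sigma> (g \<otimes> h) (tensor_vec v w) = tensor_vec (\<rho> g v) (\<sigma> h w)"
  by (simp add: tens.abs_eq D4_sq_act_abs act_single tensor_map_tensor_vec
      D4_moduleD(1)[OF \<rho>] D4_moduleD(1)[OF \<sigma>])

lemma D4_sq_act_scale: "D4_sq_act \<rho> \<sigma> (D4_sq_scale c 1) t = c *s t"
proof (rule linear_tensor_ext[OF D4_sq_act_linear])
  show "Vector_Spaces.linear (*s) (*s) ((*s) c :: 'k ^ ('i \<times> 'j) \<Rightarrow> _)"
    by (rule vec.linear_scale_self)
  have "D4_sq_scale c 1 = D4_of c \<otimes> 1"
    using tens_simps(3)[of c 1 1] by (simp add: tens_one)
  then show "D4_sq_act \<rho> \<sigma> (D4_sq_scale c 1) (tensor_vec v w) = c *s tensor_vec v w" for v w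
    by (simp add: D4_sq_act_tens D4_moduleD(3)[OF \<rho>] D4_moduleD(4)[OF \<sigma>] tensor_vec_bilinear)
qed

lemma D4_module_tensor: "D4_module (\<rho> \<otimes>\<^sub>m \<sigma>)"
  unfolding D4_module_def tensor_mod_def
  using D4_sq_act_scale[of 1]
  by (simp add: D4_sq_act_linear D4_comult_simps D4_sq_act_add D4_sq_act_mult D4_sq_act_scale
      module.scale_one[OF module_D4_sq_scale])

lemma tensor_mod_gen:
  "(\<rho> \<otimes>\<^sub>m \<sigma>) D4a (tensor_vec v w) = tensor_vec (\<rho> D4a v) (\<sigma> D4b w) + tensor_vec v (\<sigma> D4a w)"
  "(\<rho> \<otimes>\<^sub>m \<sigma>) D4b (tensor_vec v w) = tensor_vec (\<rho> D4b v) (\<sigma> D4b w)"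
  "(\<rho> \<otimes>\<^sub>m \<sigma>) D4c (tensor_vec v w) = tensor_vec (\<rho> D4c v) (\<sigma> D4c w)"
  "(\<rho> \<otimes>\<^sub>m \<sigma>) D4d (tensor_vec v w) = tensor_vec (\<rho> D4d v) (\<sigma> D4c w) + tensor_vec v (\<sigma> D4d w)"
  by (simp_all add: tensor_mod_def D4_comult_gen D4_sq_act_add D4_sq_act_tens D4_moduleD(4)[OF \<rho>])

lemma D4_module_direct_sum: "D4_module (\<rho> \<oplus> \<sigma>)"
proof -
  have add: "\<rho> h (x + y) = \<rho> h x + \<rho> h y" "\<sigma> h (x' + y') = \<sigma> h x' + \<sigma> h y'"
    and scale: "\<rho> h (c *s x) = c *s \<rho> h x" "\<sigma> h (c *s x') = c *s \<sigma> h x'" for h x y x' y' c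
    using D4_moduleD(1)[OF \<rho>, of h] D4_moduleD(1)[OF \<sigma>, of h]
    by (simp_all add: Vector_Spaces.linear_iff)
  define L :: "'k ^ ('i + 'j) \<Rightarrow> 'k ^ 'i" where "L = (\<lambda>v. \<chi> i. v $ Inl i)"
  define R :: "'k ^ ('i + 'j) \<Rightarrow> 'k ^ 'j" where "R = (\<lambda>v. \<chi> j. v $ Inr j)"
  have sum: "(\<rho> \<oplus> \<sigma>) h v = (\<chi> s. case s of Inl i \<Rightarrow> \<rho> h (L v) $ i | Inr j \<Rightarrow> \<sigma> h (R v) $ j)" for h v
    unfolding direct_sum_def L_def R_def by (rule refl)
  have LR: "L (v + w) = L v + L w" "R (v + w) = R v + R w" "L (c *s v) = c *s L v"
    "R (c *s v) = c *s R v" "L ((\<rho> \<oplus> \<sigma>) h v) = \<rho> h (L v)" "R ((\<rho> \<oplus> \<sigma>) h v) = \<sigma> h (R v)"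
    for v w c h
    unfolding sum by (simp_all add: vec_eq_iff L_def R_def)
  have inj: "v = w" if "L v = L w" "R v = R w" for v w
  proof -
    have "v $ s = w $ s" for s
      using that by (cases s) (simp_all add: L_def R_def vec_eq_iff)
    then show ?thesis by (simp add: vec_eq_iff)
  qed
  show ?thesis
    unfolding D4_module_def Vector_Spaces.linear_iff
    by (intro conjI allI inj vec.vector_space_axioms)
       (simp_all only: LR add scale D4_moduleD(2-5)[OF \<rho>] D4_moduleD(2-5)[OF \<sigma>])
qed

end


section \<open>The modules $P(r)$\<close>

text \<open>\<open>(- 1)\<^sup>r\<close> for \<open>r \<in> \<int>/2\<close>.\<close>

definition sgn2 :: "bit \<Rightarrow> 'k::field" where
  "sgn2 r = (if r = 0 then 1 else - 1)"

text \<open>The basis vector \<open>v\<^sub>i\<close> is \<open>axis i 1\<close>.\<close>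

fun P_gen :: "bit \<Rightarrow> gen \<Rightarrow> 'k::field ^ 4 \<Rightarrow> 'k ^ 4" where
  "P_gen r Ga v = v $ 1 *s axis 2 1 + v $ 3 *s axis 4 1"
| "P_gen r Gd v = v $ 1 *s axis 3 1 + v $ 2 *s (- axis 4 1)"
| "P_gen r Gb v = (v $ 1 * sgn2 r) *s axis 1 1 + (v $ 2 * sgn2 (r + 1)) *s axis 2 1
    + (v $ 3 * sgn2 (r + 1)) *s axis 3 1 + (v $ 4 * sgn2 r) *s axis 4 1"
| "P_gen r Gc v = (v $ 1 * sgn2 r) *s axis 1 1 + (v $ 2 * sgn2 (r + 1)) *s axis 2 1
    + (v $ 3 * sgn2 (r + 1)) *s axis 3 1 + (v $ 4 * sgn2 r) *s axis 4 1"

definition free_act :: "(gen \<Rightarrow> 'k::field ^ 'i \<Rightarrow> 'k ^ 'i) \<Rightarrow> (word \<Rightarrow>\<^sub>0 'k) \<Rightarrow> 'k ^ 'i \<Rightarrow> 'k ^ 'i::finite"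
  where "free_act F x v = lin_ext (*s) (\<lambda>w. foldr F (letters w) v) x"

lemma free_act_simps:
  "free_act F (x + y) v = free_act F x v + free_act F y v"
  "free_act F (x - y) v = free_act F x v - free_act F y v"
  "free_act F (- x) v = - free_act F x v"
  "free_act F 0 v = 0" "free_act F 1 v = v"
  "free_act F (Poly_Mapping.single w c) v = c *s foldr F (letters w) v"
  "free_act F (free_gen g) v = F g v"
  by (simp_all add: free_act_def lin_ext_add lin_ext_diff lin_ext_uminus lin_ext_single
      vec.module_axioms flip: single_one)

context
  fixes F :: "gen \<Rightarrow> 'k::field ^ 'i \<Rightarrow> 'k ^ 'i::finite"
  assumes F: "\<And>g. Vector_Spaces.linear (*s) (*s) (F g)"
begin

lemma free_act_linear: "Vector_Spaces.linear (*s) (*s) (free_act F x)"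
proof -
  have add: "F g (v + w) = F g v + F g w" and scale: "F g (c *s v) = c *s F g v" for g v w c
    using F[of g] by (simp_all add: Vector_Spaces.linear_iff)
  have fadd: "foldr F l (v + w) = foldr F l v + foldr F l w"
    and fscale: "foldr F l (c *s v) = c *s foldr F l v" for l v w c
    by (induction l) (simp_all add: add scale)
  have *: "free_act F x (v + w) = free_act F x v + free_act F x w \<and>
      free_act F x (c *s v) = c *s free_act F x v" for v w c
    by (induction x rule: pm_single_induct)
       (simp_all add: free_act_simps(1,4,6) fadd fscale vec.scale_right_distrib vec.scale_left_commute)
  show ?thesis
    by unfold_locales (simp_all add: *)
qed

lemma free_act_mult: "free_act F (x * y) v = free_act F x (free_act F y v)"
proof -
  have add: "free_act F z (v + w) = free_act F z v + free_act F z w"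
    and scale: "free_act F z (c *s v) = c *s free_act F z v" for z v w c
    using free_act_linear[of z] by (simp_all add: Vector_Spaces.linear_iff)
  have zero: "free_act F z 0 = 0" for z
    using scale[of z 0 0] by simp
  show ?thesis
  proof (induction x rule: pm_single_induct)
    case (single u c)
    show ?case
    proof (induction y rule: pm_single_induct)
      case (single w e)
      have "free_act F (Poly_Mapping.single u c) (free_act F (Poly_Mapping.single w e) v)
          = e *s free_act F (Poly_Mapping.single u c) (foldr F (letters w) v)"
        unfolding free_act_simps(6)[of F w] by (rule scale)
      then show ?case by (simp add: mult_single free_act_simps(6) mult.commute)
    qed (simp_all add: free_act_simps(1,4) zero add distrib_left)
  qed (simp_all add: free_act_simps(1,4) distrib_right)
qed

lemma free_act_ideal:
  assumes "\<And>r v. r \<in> R \<Longrightarrow> free_act F r v = 0" and "x \<in> ideal_gen R"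
  shows "free_act F x v = 0"
proof -
  have "free_act F z (c *s w) = c *s free_act F z w" for z w c
    using free_act_linear[of z] by (simp add: Vector_Spaces.linear_iff)
  from this[of _ 0 0] have zero: "free_act F z 0 = 0" for z
    by simp
  show ?thesis
    using assms(2)
    by (induction arbitrary: v rule: ideal_gen.induct)
       (simp_all add: free_act_simps(1,4) free_act_mult zero assms(1))
qed

end

lemma P_gen_linear: "Vector_Spaces.linear (*s) (*s) (P_gen r g)"
  by (cases g; unfold_locales) (simp_all add: vec_eq_iff algebra_simps)

lemma P_gen_relators:
  assumes "x \<in> D4_relators"
  shows "free_act (P_gen r) x v = 0"
  using assms unfolding D4_relators_def Let_def
  by (cases r)
     (auto simp: free_act_simps free_act_mult P_gen_linear vec_eq_iff forall_4 axis_def sgn2_def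
        simp del: diff_0_right)

lift_definition P :: "bit \<Rightarrow> 'k::field D4 \<Rightarrow> 'k ^ 4 \<Rightarrow> 'k ^ 4" is "\<lambda>r. free_act (P_gen r)"
proof (rule ext)
  fix r and x y :: "word \<Rightarrow>\<^sub>0 'k" and v
  assume "x - y \<in> ideal_gen D4_relators"
  then have "free_act (P_gen r) (x - y) v = 0"
    by (rule free_act_ideal[OF P_gen_linear, rotated]) (rule P_gen_relators)
  then show "free_act (P_gen r) x v = free_act (P_gen r) y v"
    by (simp add: free_act_simps)
qed

lemma D4_module_P: "D4_module (P r)"
  unfolding D4_module_def
  by (transfer; simp add: free_act_linear free_act_simps free_act_mult P_gen_linear)

lemma P_basis:
  "P r D4a (axis 1 1) = axis 2 1" "P r D4d (axis 1 1) = axis 3 1"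
  "P r D4a (axis 2 1) = 0" "P r D4d (axis 2 1) = - axis 4 1"
  "P r D4a (axis 3 1) = axis 4 1" "P r D4d (axis 3 1) = 0"
  "P r D4a (axis 4 1) = 0" "P r D4d (axis 4 1) = 0"
  "i \<in> {1, 4} \<Longrightarrow> P r D4b (axis i 1) = sgn2 r *s axis i 1"
  "i \<in> {1, 4} \<Longrightarrow> P r D4c (axis i 1) = sgn2 r *s axis i 1"
  "i \<in> {2, 3} \<Longrightarrow> P r D4b (axis i 1) = sgn2 (r + 1) *s axis i 1"
  "i \<in> {2, 3} \<Longrightarrow> P r D4c (axis i 1) = sgn2 (r + 1) *s axis i 1"
  by (transfer, force simp: free_act_simps vec_eq_iff forall_4 axis_def)+

end

theory Submission
  imports Defs
begin

text \<open>On these modules \<open>b\<close> and \<open>c\<close> act equally, so \<open>a\<close> and \<open>d\<close> anticommute and a vector \<open>w\<close> on which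
  \<open>b, c\<close> act as \<open>(- 1)\<^sup>s\<close> is the image of \<open>v\<^sub>1\<close> under a homomorphism from \<open>P(s)\<close>.  The four vectors
  \<open>v\<^sub>1 \<otimes> v\<^sub>j\<close> of \<open>P(r') \<otimes> P(r)\<close> have sign \<open>(- 1)\<^bsup>r + r'\<^esup>\<close> for \<open>j = 1, 4\<close> and the opposite sign for
  \<open>j = 2, 3\<close>.  They generate the tensor product as a module, because
  \<open>a (v\<^sub>1 \<otimes> w) = v\<^sub>2 \<otimes> b w + v\<^sub>1 \<otimes> a w\<close> with \<open>b\<close> invertible, and similarly for \<open>v\<^sub>3\<close> and \<open>v\<^sub>4\<close>.
  So they give a surjection from \<open>2 P(0) \<oplus> 2 P(1)\<close>, and both sides have dimension 16.\<close>

section \<open>Linear algebra and induction over the algebra\<close>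

text \<open>Relabelling the coordinates of the target turns \<open>f\<close> into a surjective
  endomorphism of \<open>'k ^ 'i\<close>, which is injective in finite dimension. The index types
  differ in the application: an iterated sum against a product.\<close>

lemma linear_surj_imp_inj_cart:
  fixes f :: "'k::field ^ 'i \<Rightarrow> 'k ^ 'j"
  assumes f: "Vector_Spaces.linear (*s) (*s) f" and surj: "surj f"
    and card: "CARD('i) = CARD('j)"
  shows "inj f"
proof -
  obtain h :: "'i \<Rightarrow> 'j" where h: "bij h"
    using finite_same_card_bij[OF _ _ card] by auto
  define R :: "'k ^ 'j \<Rightarrow> 'k ^ 'i" where "R x = (\<chi> i. x $ h i)" for x
  have R: "Vector_Spaces.linear (*s) (*s) R"
    by unfold_locales (simp_all add: R_def vec_eq_iff)
  have "surj R"
  proof (rule surjI)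
    show "R (\<chi> j. y $ inv h j) = y" for y
      using h by (simp add: R_def vec_eq_iff bij_is_inj)
  qed
  then have "surj (\<lambda>x. R (f x))"
    using surj comp_surj[of f R] by (simp add: o_def)
  then have "inj (\<lambda>x. R (f x))"
    using vec.linear_surjective_imp_injective[OF linear_comp[OF R f]] by simp
  then show ?thesis
    by (auto simp: inj_def)
qed

text \<open>Every element comes from the free algebra, so it is a sum of scalar multiples of words,
  and words are products of generators.\<close>

lemma D4_induct [case_names scalar gen add mult]:
  assumes scalar: "\<And>c. Q (D4_of c)" and gen: "\<And>g. Q (D4_gen g)"
    and add: "\<And>x y. Q x \<Longrightarrow> Q y \<Longrightarrow> Q (x + y)"
    and mult: "\<And>x y. Q x \<Longrightarrow> Q y \<Longrightarrow> Q (x * y)"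
  shows "Q (x :: 'k::field D4)"
proof (induct x rule: D4.abs_induct)
  case (1 y)
  show ?case
  proof (induction y rule: pm_single_induct)
    case zero
    then show ?case
      using scalar[of 0] by (simp add: D4_of_simps zero_D4.abs_eq)
  next
    case (single w c)
    have "Q (abs_D4 (Poly_Mapping.single (Word l) c))" for l
    proof (induction l)
      case Nil
      then show ?case
        using scalar[of c] by (simp add: D4_of.abs_eq zero_word_def)
    next
      case (Cons g l)
      have "abs_D4 (Poly_Mapping.single (Word (g # l)) c)
          = D4_gen g * abs_D4 (Poly_Mapping.single (Word l) c)"
        by (simp add: D4_gen.abs_eq times_D4.abs_eq mult_single plus_word_def)
      then show ?case
        using Cons mult gen by simp
    qed
    from this[of "letters w"] show ?case by simp
  next
    case (add x y)
    then show ?case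
      using assms(3) by (simp flip: plus_D4.abs_eq)
  qed
qed

section \<open>Homomorphisms and direct sums\<close>

definition D4_hom :: "('k::field D4 \<Rightarrow> 'k ^ 'i \<Rightarrow> 'k ^ 'i::finite) \<Rightarrow>
    ('k D4 \<Rightarrow> 'k ^ 'j \<Rightarrow> 'k ^ 'j::finite) \<Rightarrow> ('k ^ 'i \<Rightarrow> 'k ^ 'j) \<Rightarrow> bool" where
  "D4_hom \<rho> \<sigma> f \<longleftrightarrow> Vector_Spaces.linear (*s) (*s) f \<and> (\<forall>h v. f (\<rho> h v) = \<sigma> h (f v))"

text \<open>The elements \<open>h\<close> whose action commutes with \<open>f\<close> form a
  subalgebra, so the four generators suffice.\<close>

lemma D4_homI:
  assumes \<rho>: "D4_module \<rho>" and \<sigma>: "D4_module \<sigma>" and f: "Vector_Spaces.linear (*s) (*s) f"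
    and gen: "\<And>g v. f (\<rho> (D4_gen g) v) = \<sigma> (D4_gen g) (f v)"
  shows "D4_hom \<rho> \<sigma> f"
proof -
  have "\<forall>v. f (\<rho> h v) = \<sigma> h (f v)" for h
  proof (induct h rule: D4_induct)
    case (scalar c)
    then show ?case
      using f by (simp add: D4_moduleD(3)[OF \<rho>] D4_moduleD(3)[OF \<sigma>] Vector_Spaces.linear_iff)
  next
    case (add x y)
    then show ?case
      using f by (simp add: D4_moduleD(2)[OF \<rho>] D4_moduleD(2)[OF \<sigma>] Vector_Spaces.linear_iff)
  qed (simp_all add: gen D4_moduleD(5)[OF \<rho>] D4_moduleD(5)[OF \<sigma>])
  then show ?thesis
    using f by (simp add: D4_hom_def)
qed

lemma D4_hom_surj_imp_iso:
  fixes \<rho> :: "'k::field D4 \<Rightarrow> 'k ^ 'i \<Rightarrow> 'k ^ 'i" and \<sigma> :: "'k D4 \<Rightarrow> 'k ^ 'j \<Rightarrow> 'k ^ 'j"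
  assumes \<rho>: "D4_module \<rho>" and \<sigma>: "D4_module \<sigma>" and f: "D4_hom \<rho> \<sigma> f"
    and surj: "surj f" and card: "CARD('i) = CARD('j)"
  shows "\<sigma> \<cong> \<rho>"
proof -
  have lin: "Vector_Spaces.linear (*s) (*s) f" and eq: "f (\<rho> h v) = \<sigma> h (f v)" for h v
    using f by (simp_all add: D4_hom_def)
  have inj: "inj f"
    by (rule linear_surj_imp_inj_cart[OF lin surj card])
  \<comment> \<open>Rewriting with this equivalence reduces every property of \<open>inv f\<close>
    to one of \<open>f\<close>.\<close>
  have inv: "inv f x = y \<longleftrightarrow> x = f y" for x y
    using inj surj by (metis inv_f_f surj_f_inv_f)
  have "Vector_Spaces.linear (*s) (*s) (inv f)"
    using lin surj_f_inv_f[OF surj] unfolding Vector_Spaces.linear_iff inv by simp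
  moreover have "bij (inv f)"
    using inj surj by (intro bij_imp_bij_inv bijI)
  moreover have "inv f (\<sigma> h v) = \<rho> h (inv f v)" for h v
    unfolding inv by (simp add: eq surj_f_inv_f[OF surj])
  ultimately show ?thesis
    using \<rho> \<sigma> unfolding D4_iso_def by blast
qed

text \<open>The map out of a direct sum given by its universal property.\<close>

definition copair :: "('k::field ^ 'i \<Rightarrow> 'k ^ 'm) \<Rightarrow> ('k ^ 'j \<Rightarrow> 'k ^ 'm) \<Rightarrow>
    'k ^ ('i::finite + 'j::finite) \<Rightarrow> 'k ^ 'm::finite" where
  "copair f g v = f (\<chi> i. v $ Inl i) + g (\<chi> j. v $ Inr j)"

lemma D4_hom_copair:
  assumes f: "D4_hom \<rho> \<tau> f" and g: "D4_hom \<sigma> \<tau> g" and \<tau>: "D4_module \<tau>"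
  shows "D4_hom (\<rho> \<oplus> \<sigma>) \<tau> (copair f g)"
proof -
  have lin: "f (x + y) = f x + f y" "f (c *s x) = c *s f x"
    "g (x' + y') = g x' + g y'" "g (c *s x') = c *s g x'"
    "\<tau> h (z + z') = \<tau> h z + \<tau> h z'" for x y x' y' c h z z'
    using f g D4_moduleD(1)[OF \<tau>] by (simp_all add: D4_hom_def Vector_Spaces.linear_iff)
  have proj: "(\<chi> i. (v + w) $ Inl i) = (\<chi> i. v $ Inl i) + (\<chi> i. w $ Inl i)"
    "(\<chi> i. (v + w) $ Inr i) = (\<chi> i. v $ Inr i) + (\<chi> i. w $ Inr i)"
    "(\<chi> i. (c *s v) $ Inl i) = c *s (\<chi> i. v $ Inl i)"
    "(\<chi> i. (c *s v) $ Inr i) = c *s (\<chi> i. v $ Inr i)" for v w :: "'a ^ ('b + 'd)" and c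
    by (simp_all add: vec_eq_iff)
  have "Vector_Spaces.linear (*s) (*s) (copair f g)"
    unfolding Vector_Spaces.linear_iff copair_def proj lin
    by (simp add: vec.vector_space_axioms vec.scale_right_distrib)
  moreover have "copair f g ((\<rho> \<oplus> \<sigma>) h v) = \<tau> h (copair f g v)" for h v
    using f g by (simp add: copair_def direct_sum_def lin D4_hom_def)
  ultimately show ?thesis
    by (simp add: D4_hom_def)
qed

lemma D4_hom_range_subset_copair:
  assumes "D4_hom \<rho> \<tau> f" "D4_hom \<sigma> \<tau> g"
  shows "range f \<subseteq> range (copair f g)" "range g \<subseteq> range (copair f g)"
proof -
  have zero: "f 0 = 0" "g 0 = 0"
    using assms vec.linear_0 by (auto simp: D4_hom_def)
  have *: "f x + g y \<in> range (copair f g)" for x y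
    by (rule range_eqI[of _ _ "\<chi> s. case s of Inl i \<Rightarrow> x $ i | Inr j \<Rightarrow> y $ j"])
      (simp add: copair_def)
  show "range f \<subseteq> range (copair f g)" "range g \<subseteq> range (copair f g)"
    using *[of _ 0] *[of 0] by (auto simp: zero)
qed

section \<open>Homomorphisms out of P(s)\<close>

text \<open>This is the mapping property of P(s): its basis is v1, a v1, d v1, a d v1, and the
  relations of the algebra force the remaining products once \<open>b\<close> and \<open>c\<close>
  act on the generator by the given sign.\<close>

lemma D4_hom_P:
  fixes \<rho> :: "'k::field D4 \<Rightarrow> 'k ^ 'i \<Rightarrow> 'k ^ 'i"
  assumes \<rho>: "D4_module \<rho>" and b: "\<rho> D4b w = sgn2 s *s w" and c: "\<rho> D4c w = sgn2 s *s w"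
  obtains f where "D4_hom (P s) \<rho> f" "f (axis 1 1) = w"
proof
  let ?a = "\<rho> D4a" and ?b = "\<rho> D4b" and ?c = "\<rho> D4c" and ?d = "\<rho> D4d"
  \<comment> \<open>The values are forced by v2 = a v1, v3 = d v1 and v4 = a v3.\<close>
  define f where "f v = v $ 1 *s w + v $ 2 *s ?a w + v $ 3 *s ?d w + v $ 4 *s ?a (?d w)"
    for v :: "'k ^ 4"
  have lin: "\<rho> h (x + y) = \<rho> h x + \<rho> h y" "\<rho> h (k *s x) = k *s \<rho> h x" for h x y k
    using D4_moduleD(1)[OF \<rho>] by (simp_all add: Vector_Spaces.linear_iff)
  have minus: "\<rho> h (- x) = - \<rho> h x" and zero: "\<rho> h 0 = 0" for h x
    using lin(2)[of h "- 1" x] lin(2)[of h 0 0] by (simp_all add: vec.scale_minus_left)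
  have neg: "\<rho> (- g) x = - \<rho> g x" for g x
    using D4_moduleD(2)[OF \<rho>, of g "- g" x] D4_moduleD(2)[OF \<rho>, of 0 0 x]
    by (simp add: eq_neg_iff_add_eq_0 add.commute)
  have diff: "\<rho> (g - h) x = \<rho> g x - \<rho> h x" for g h x
    using D4_moduleD(2)[OF \<rho>, of g "- h" x] by (simp add: neg)
  have zero': "\<rho> 0 x = 0" for x
    using diff[of 0 0 x] by simp
  note act = D4_moduleD(2,4,5)[OF \<rho>] neg diff zero'
  have rel: "?b (?a x) = - ?a (?b x)" "?c (?a x) = - ?a (?c x)"
    "?b (?d x) = - ?d (?b x)" "?c (?d x) = - ?d (?c x)"
    "?a (?a x) = 0" "?d (?d x) = 0" "?d (?a x) + ?a (?d x) = x - ?b (?c x)" for x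
    using arg_cong[OF D4_relations(1), of "\<lambda>h. \<rho> h x"] arg_cong[OF D4_relations(2), of "\<lambda>h. \<rho> h x"]
      arg_cong[OF D4_relations(3), of "\<lambda>h. \<rho> h x"] arg_cong[OF D4_relations(4), of "\<lambda>h. \<rho> h x"]
      arg_cong[OF D4_relations(6), of "\<lambda>h. \<rho> h x"] arg_cong[OF D4_relations(9), of "\<lambda>h. \<rho> h x"]
      arg_cong[OF D4_relations(10), of "\<lambda>h. \<rho> h x"]
    by (simp_all add: act)
  have sgn: "sgn2 s * sgn2 s = (1 :: 'k)"
    by (cases s; simp add: sgn2_def)
  \<comment> \<open>Since \<open>b c\<close> fixes \<open>w\<close>, the relation da + ad = 1 - bc
    gives anticommutation on \<open>w\<close>; this matches d v2 = -v4. Applying \<open>d\<close>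
    once more matches d v4 = 0.\<close>
  have da: "?d (?a w) = - ?a (?d w)"
    using rel(7)[of w] by (simp add: b c lin sgn vec.scale_scale eq_neg_iff_add_eq_0)
  have dad: "?d (?a (?d w)) = 0"
    using arg_cong[OF da, of ?d] by (simp add: minus rel)
  have "Vector_Spaces.linear (*s) (*s) f"
    by unfold_locales (simp_all add: f_def vec.scale_left_distrib vec.scale_right_distrib)
  moreover have "f (P s (D4_gen g) v) = \<rho> (D4_gen g) (f v)" for g v
  proof -
    have "P s (D4_gen g) v = P_gen s g v"
      by transfer (simp add: free_act_simps)
    then show ?thesis
      by (cases g; cases s)
         (simp_all add: f_def lin rel minus zero da dad b c sgn2_def axis_def)
  qed
  ultimately show "D4_hom (P s) \<rho> f"
    by (rule D4_homI[OF D4_module_P \<rho>])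
  show "f (axis 1 1) = w"
    by (simp add: f_def axis_def)
qed

section \<open>Generation and assembly of the isomorphism\<close>

lemma P_tensor_generated:
  fixes \<sigma> :: "'k::field D4 \<Rightarrow> 'k ^ 'j \<Rightarrow> 'k ^ 'j"
  assumes \<sigma>: "D4_module \<sigma>" and N: "vec.subspace N"
    and act: "\<And>h t. t \<in> N \<Longrightarrow> (P r \<otimes>\<^sub>m \<sigma>) h t \<in> N"
    and gen: "\<And>j. tensor_vec (axis 1 1) (axis j 1) \<in> N"
  shows "N = UNIV"
proof -
  have bb: "\<sigma> D4b (\<sigma> D4b w) = w" and cc: "\<sigma> D4c (\<sigma> D4c w) = w" for w
    using arg_cong[OF D4_relations(7), of "\<lambda>h. \<sigma> h w"] arg_cong[OF D4_relations(8), of "\<lambda>h. \<sigma> h w"]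
    by (simp_all add: D4_moduleD(4,5)[OF \<sigma>])
  note [simp] = tensor_mod_gen[OF D4_module_P \<sigma>] P_basis
  have cancel: "x \<in> N" if "x + y \<in> N" "y \<in> N" for x y
    using vec.subspace_diff[OF N that] by simp
  have 1: "tensor_vec (axis 1 1) w \<in> N" for w
  proof -
    have "tensor_vec (axis 1 1) w = (\<Sum>j\<in>UNIV. w $ j *s tensor_vec (axis 1 1) (axis j 1))"
      by (subst basis_expansion[symmetric]) (simp only: tensor_vec_sum tensor_vec_bilinear)
    also have "\<dots> \<in> N"
      by (intro vec.subspace_sum[OF N] vec.subspace_scale[OF N] gen)
    finally show ?thesis .
  qed
  \<comment> \<open>Starting from \<open>\<sigma> D4b w\<close> instead of \<open>w\<close> cancels
    the factor \<open>b\<close> in the coproduct of \<open>a\<close>, because b^2 = 1; the other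
    summand has first factor v1 and already lies in \<open>N\<close>.\<close>
  have 2: "tensor_vec (axis 2 1) w \<in> N" for w
    using cancel[OF _ 1] act[OF 1, of D4a "\<sigma> D4b w"] by (simp add: bb)
  have 3: "tensor_vec (axis 3 1) w \<in> N" for w
    using cancel[OF _ 1] act[OF 1, of D4d "\<sigma> D4c w"] by (simp add: cc)
  \<comment> \<open>Here a v3 = v4, so the summand to subtract has first factor v3.\<close>
  have 4: "tensor_vec (axis 4 1) w \<in> N" for w
    using cancel[OF _ 3] act[OF 3, of D4a "\<sigma> D4b w"] by (simp add: bb)
  have "tensor_vec (axis i 1) w \<in> N" for i w
    using exhaust_4[of i] 1 2 3 4 by auto
  then have ax: "axis p 1 \<in> N" for p
    by (metis surj_pair tensor_vec_axis)
  have "x \<in> N" for x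
    using vec.subspace_sum[OF N, of UNIV "\<lambda>p. x $ p *s axis p 1"] vec.subspace_scale[OF N ax]
    by (simp add: basis_expansion)
  then show ?thesis by auto
qed

text \<open>The map \<open>j\<close> orders the generators v1 \<otimes> v_k so that the first two
  have sign 0 and the last two sign 1, as the summands of the target require. Leaving
  \<open>j\<close> open treats equal and distinct \<open>r\<close>, \<open>r'\<close> by one
  argument.\<close>

lemma D4_iso_P_tensor:
  fixes j :: "4 \<Rightarrow> 4" and r r' :: bit
  assumes j: "surj j"
    and s: "\<And>i. i \<in> {1, 2} \<Longrightarrow> r' + (if j i \<in> {1, 4} then r else r + 1) = 0"
      "\<And>i. i \<in> {3, 4} \<Longrightarrow> r' + (if j i \<in> {1, 4} then r else r + 1) = 1"
  shows "(P r' :: 'k::field D4 \<Rightarrow> _) \<otimes>\<^sub>m P r \<cong> (P 0 \<oplus> P 0) \<oplus> (P 1 \<oplus> P 1)"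
proof -
  let ?M = "(P r' :: 'k D4 \<Rightarrow> _) \<otimes>\<^sub>m P r"
  have M: "D4_module ?M"
    by (rule D4_module_tensor[OF D4_module_P D4_module_P])
  define w :: "4 \<Rightarrow> 'k ^ (4 \<times> 4)" where "w i = tensor_vec (axis 1 1) (axis (j i) 1)" for i
  have sgn: "sgn2 r' * sgn2 y = (sgn2 (r' + y) :: 'k)" for y
    by (cases r'; cases y; simp add: sgn2_def)
  have sign: "?M h (tensor_vec (axis 1 1) (axis k 1))
      = sgn2 (r' + (if k \<in> {1, 4} then r else r + 1)) *s tensor_vec (axis 1 1) (axis k 1)"
    if "h \<in> {D4b, D4c}" for h k
  proof -
    have "P q h (axis i 1) = sgn2 (if i \<in> {1, 4} then q else q + 1) *s (axis i 1 :: 'k ^ 4)" for q i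
      using exhaust_4[of i] that by (auto simp: P_basis)
    note P = this[of r' 1] this[of r k]
    have "?M h (tensor_vec (axis 1 1) (axis k 1))
        = tensor_vec (P r' h (axis 1 1)) (P r h (axis k 1))"
      using that by (auto simp: tensor_mod_gen[OF D4_module_P D4_module_P])
    also have "\<dots> = (sgn2 r' * sgn2 (if k \<in> {1, 4} then r else r + 1))
        *s tensor_vec (axis 1 1) (axis k 1)"
      unfolding P tensor_vec_bilinear by (simp add: vec.scale_scale mult.commute)
    finally show ?thesis
      unfolding sgn .
  qed
  have w: "?M D4b (w i) = sgn2 (r' + (if j i \<in> {1, 4} then r else r + 1)) *s w i"
    "?M D4c (w i) = sgn2 (r' + (if j i \<in> {1, 4} then r else r + 1)) *s w i" for i
    unfolding w_def by (rule sign; blast)+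
  have hom: "\<exists>f. D4_hom (P s) ?M f \<and> f (axis 1 1) = w i"
    if "r' + (if j i \<in> {1, 4} then r else r + 1) = s" for s i
    using D4_hom_P[OF M w[of i, unfolded that]] by blast
  obtain f1 where f1: "D4_hom (P 0) ?M f1" "f1 (axis 1 1) = w 1"
    using hom[OF s(1)[of 1]] by blast
  obtain f2 where f2: "D4_hom (P 0) ?M f2" "f2 (axis 1 1) = w 2"
    using hom[OF s(1)[of 2]] by blast
  obtain f3 where f3: "D4_hom (P 1) ?M f3" "f3 (axis 1 1) = w 3"
    using hom[OF s(2)[of 3]] by blast
  obtain f4 where f4: "D4_hom (P 1) ?M f4" "f4 (axis 1 1) = w 4"
    using hom[OF s(2)[of 4]] by blast
  define F where "F = copair (copair f1 f2) (copair f3 f4)"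
  note f12 = D4_hom_copair[OF f1(1) f2(1) M] and f34 = D4_hom_copair[OF f3(1) f4(1) M]
  have F: "D4_hom ((P 0 \<oplus> P 0) \<oplus> (P 1 \<oplus> P 1)) ?M F"
    unfolding F_def by (rule D4_hom_copair[OF f12 f34 M])
  note R12 = D4_hom_range_subset_copair[OF f1(1) f2(1)]
    and R34 = D4_hom_range_subset_copair[OF f3(1) f4(1)]
    and R = D4_hom_range_subset_copair[OF f12 f34]
  have "range f1 \<union> range f2 \<union> range f3 \<union> range f4 \<subseteq> range F"
    unfolding F_def
    by (intro Un_least order_trans[OF R12(1) R(1)] order_trans[OF R12(2) R(1)]
        order_trans[OF R34(1) R(2)] order_trans[OF R34(2) R(2)])
  moreover have "w 1 \<in> range f1" "w 2 \<in> range f2" "w 3 \<in> range f3" "w 4 \<in> range f4"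
    by (simp_all flip: f1(2) f2(2) f3(2) f4(2))
  ultimately have "w i \<in> range F" for i
    using exhaust_4[of i] by (elim disjE) (simp_all add: subset_iff)
  \<comment> \<open>Surjectivity of \<open>j\<close> ensures that no generator is left out.\<close>
  then have gen: "tensor_vec (axis 1 1) (axis i 1) \<in> range F" for i
    using j by (metis surj_def w_def)
  have lin: "Vector_Spaces.linear (*s) (*s) F"
    and eq: "?M h (F v) = F (((P 0 \<oplus> P 0) \<oplus> (P 1 \<oplus> P 1)) h v)" for h v
    using F by (simp_all add: D4_hom_def)
  have "range F = UNIV"
  proof (rule P_tensor_generated[OF D4_module_P])
    show "vec.subspace (range F)"
      by (rule vec.linear_subspace_image[OF lin vec.subspace_UNIV])
    show "?M h t \<in> range F" if "t \<in> range F" for h t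
      using that by (auto simp: eq)
  qed (rule gen)
  then show ?thesis
    by (intro D4_hom_surj_imp_iso[OF _ M F] D4_module_direct_sum D4_module_P) simp_all
qed

theorem corollary2p11:
  fixes r r' :: bit
  assumes "CHAR('k::alg_closed_field) \<noteq> 2"
  shows "(P r' :: 'k D4 \<Rightarrow> 'k ^ 4 \<Rightarrow> 'k ^ 4) \<otimes>\<^sub>m P r \<cong> (P 0 \<oplus> P 0) \<oplus> (P 1 \<oplus> P 1)"
proof (cases "r' = r")
  case True
  \<comment> \<open>Now r' + r = 0, so the indices 1 and 4 come first; surjectivity is shown by the
    inverse permutation.\<close>
  let ?j = "\<lambda>i :: 4. if i = 1 then 1 else if i = 2 then 4 else if i = 3 then 2 else 3 :: 4"
  have "?j (if y = 4 then 2 else if y = 2 then 3 else if y = 3 then 4 else 1) = y" for y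
    using exhaust_4[of y] by auto
  then have "surj ?j" by (rule surjI)
  then show ?thesis
    by (rule D4_iso_P_tensor) (use True in \<open>cases r; auto\<close>)+
next
  case False
  \<comment> \<open>Now r' + r = 1, so it is the indices 2 and 3 that give sign 0.\<close>
  let ?j = "\<lambda>i :: 4. if i = 1 then 2 else if i = 2 then 3 else if i = 3 then 1 else 4 :: 4"
  have "?j (if y = 2 then 1 else if y = 3 then 2 else if y = 1 then 3 else 4) = y" for y
    using exhaust_4[of y] by auto
  then have "surj ?j" by (rule surjI)
  then show ?thesis
    by (rule D4_iso_P_tensor) (use False in \<open>cases r; cases r'; auto\<close>)+
qed

end
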